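(* Let $(\mathcal{A},\varepsilon)$ be the full-dimensional signed support of a bivariate $5$-nomial (so $\mathcal{A}\subseteq\mathbb{R}^2$, $\#\mathcal{A}=5$, $\dim\operatorname{Conv}(\mathcal{A})=2$) with Gale dual matrix $B\in\mathbb{R}^{5\times2}$. The map $\bar\xi_{B,\varepsilon}$ has two critical points only if $\#\mathcal{A}_+=3$, $\#\mathcal{A}_-=2$ and $\dim\operatorname{Conv}(\mathcal{A}_+)=2$, or $\#\mathcal{A}_+=2$, $\#\mathcal{A}_-=3$ and $\dim\operatorname{Conv}(\mathcal{A}_-)=2$. Assume that $\mathcal{A}_+=\{\alpha_1,\alpha_2,\alpha_3\}$, $\mathcal{A}_-=\{\alpha_4,\alpha_5\}$ and $P=\operatorname{Conv}(\mathcal{A}_+)$ has dimension $2$. Let $M\in\mathbb{R}^{2\times2}$ be an invertible matrix such that $M(\alpha_2-\alpha_1)=e_1$, $M(\alpha_3-\alpha_1)=e_2$, and let $v=-M\alpha_1$. Denote $(x_1,y_1)^\top=M\alpha_4+v$, $(x_2,y_2)^\top=M\alpha_5+v$, and $$a=-x_1y_1(1-x_1-y_1),\qquad c=-x_2y_2(1-x_2-y_2),$$ $$b=-x_1^2y_2^2+2x_1x_2y_1y_2-x_2^2y_1^2+x_1^2y_2+y_2^2x_1+x_2^2y_1+y_1^2x_2-x_1y_2-x_2y_1.$$ The map $\bar\xi_{B,\varepsilon}$ has two critical points if and only if $\alpha_4\in\operatorname{int}(P^{+,j,i})$ and $\alpha_5\in\operatorname{int}(P^{+,i,j})$ for $i\neq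 j\in\{0,1,2\}$ and the coordinates of $\alpha_4$ and $\alpha_5$ satisfy the following inequalities: $$b^2-4ac>0,$$ $$b^2-4ac<(2x_2y_1(1-x_1-y_1)+b)^2,\qquad 0<2x_2y_1(1-x_1-y_1)+b,$$ $$b^2-4ac<(2x_1y_2(1-x_1-y_1)+b)^2,\qquad 0>2x_1y_2(1-x_1-y_1)+b.$$
   Context: A signed support $(\mathcal{A},\varepsilon)$ consists of a finite set $\mathcal{A}=\{\alpha_1,\dots,\alpha_5\}\subseteq\mathbb{R}^2$ of distinct exponent vectors and a sign vector $\varepsilon\in\{\pm1\}^5$; $\mathcal{A}_+=\{\alpha_i:\varepsilon_i=1\}$, $\mathcal{A}_-=\{\alpha_i:\varepsilon_i=-1\}$. Let $\hat A\in\mathbb{R}^{3\times5}$ be the matrix whose $i$-th column is $1$ followed by the entries of $\alpha_i$. A Gale dual matrix $B\in\mathbb{R}^{5\times2}$ is a matrix whose columns form a basis of $\ker(\hat A)$. Standing normalization: the last row of $B$ (the row of $\alpha_5$) is $(0,-1)$; such a choice of $B$ fixes the sign $\varepsilon_5=-1$. Define $$\bar\xi_{B,\varepsilon}:\{\mu\in\mathbb{R}:\operatorname{sign}(B\hat\mu)=\varepsilon\}\to\mathbb{R}^2,\quad\mu\mapsto B^\top\operatorname{Log}|B\hat\mu|,\qquad\hat\mu=(\mu,1)^\top,$$ with coordinate-wise sign, absolute value and natural logarithm. A critical point of $\bar\xi_{B,\varepsilon}$ is a $\mu$ in its domain at which the Jacobian matrix of $\bar\xi_{B,\varepsilon}$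 does not have full rank, i.e. at which the derivative vanishes. For a triangle $P=\operatorname{Conv}(\mu_0,\mu_1,\mu_2)\subseteq\mathbb{R}^2$ of dimension $2$, with labelled vertices, let $\mathcal{H}_{v_i,d_i}=\{\mu:v_i\cdot\mu=d_i\}$ ($i=0,1,2$) be the lines supporting the edges of $P$, chosen so that $\mu_i\notin\mathcal{H}_{v_i,d_i}$ and $P=\bigcap_{i=0}^2\mathcal{H}^+_{v_i,d_i}$, where $\mathcal{H}^+_{v,d}=\{\mu:v\cdot\mu\ge d\}$ and $\mathcal{H}^-_{v,d}=\{\mu:v\cdot\mu\le d\}$. For $i\ne j\in\{0,1,2\}$ put $D_j=v_j\cdot\mu_j>d_j$ and $$P^{+,i,j}=\Big(\bigcap_{l\in\{0,1,2\},\,l\ne i}\mathcal{H}^+_{v_l,d_l}\Big)\cap\mathcal{H}^-_{v_i,d_i}\cap\mathcal{H}^-_{v_j,D_j}.$$ Here $\operatorname{int}$ denotes the interior, and $e_1,e_2$ are the standard basis vectors of $\mathbb{R}^2$.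
   Formalization: With M fixed by the labels α1, α2, α3 the equivalence is false; here, for the pair (i,j), M and v instead send the third vertex of P to 0, vertex j to e1 and vertex i to e2 (the stated M and v when i=2, j=1). *)

theory Defs
  imports "HOL-Analysis.Analysis"
begin

text \<open>
  The support is given by its indexed exponent vectors \<open>\<alpha> $ 1, \<dots>, \<alpha> $ 5\<close>. In the index
  type \<open>5\<close> one has \<open>5 = 0\<close>, so \<open>1, \<dots>, 5\<close> are its five distinct elements.
\<close>

definition signed_support :: "real^2^5 \<Rightarrow> real^5 \<Rightarrow> bool" where
  "signed_support \<alpha> \<epsilon> \<longleftrightarrow> inj (\<lambda>i. \<alpha> $ i) \<and> (\<forall>i. \<epsilon> $ i \<in> {1, -1})"

definition pos_support :: "real^2^5 \<Rightarrow> real^5 \<Rightarrow> (real^2) set" where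
  "pos_support \<alpha> \<epsilon> = {\<alpha> $ i |i. \<epsilon> $ i = 1}"

definition neg_support :: "real^2^5 \<Rightarrow> real^5 \<Rightarrow> (real^2) set" where
  "neg_support \<alpha> \<epsilon> = {\<alpha> $ i |i. \<epsilon> $ i = -1}"

definition hat_matrix :: "real^2^5 \<Rightarrow> real^5^3" where
  "hat_matrix \<alpha> = vector [\<chi> i. 1, \<chi> i. \<alpha> $ i $ 1, \<chi> i. \<alpha> $ i $ 2]"

definition gale_dual :: "real^2^5 \<Rightarrow> real^2^5 \<Rightarrow> bool" where
  "gale_dual \<alpha> B \<longleftrightarrow> inj (\<lambda>j. column j B) \<and> independent (columns B) \<and>
     span (columns B) = {x. hat_matrix \<alpha> *v x = 0}"

definition hat :: "real \<Rightarrow> real^2" where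
  "hat \<mu> = vector [\<mu>, 1]"

definition xi_dom :: "real^2^5 \<Rightarrow> real^5 \<Rightarrow> real set" where
  "xi_dom B \<epsilon> = {\<mu>. (\<chi> i. sgn ((B *v hat \<mu>) $ i)) = \<epsilon>}"

text \<open>The sign vector enters only through the domain, hence is not an argument of \<open>xi\<close>.\<close>

definition xi :: "real^2^5 \<Rightarrow> real \<Rightarrow> real^2" where
  "xi B \<mu> = transpose B *v (\<chi> i. ln \<bar>(B *v hat \<mu>) $ i\<bar>)"

text \<open>
  The Jacobian is a \<open>2 \<times> 1\<close> matrix, so it fails to have full rank iff the derivative is zero.
  For a sign vector with entries \<open>\<plusminus>1\<close> the domain is open and \<open>xi B\<close> is differentiable on it.
\<close>

definition critical_points :: "real^2^5 \<Rightarrow> real^5 \<Rightarrow> real set" where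
  "critical_points B \<epsilon> = {\<mu> \<in> xi_dom B \<epsilon>. (xi B has_vector_derivative 0) (at \<mu>)}"

definition hyperplane :: "real^2 \<Rightarrow> real \<Rightarrow> (real^2) set" where
  "hyperplane v d = {x. v \<bullet> x = d}"

definition halfspace_ge :: "real^2 \<Rightarrow> real \<Rightarrow> (real^2) set" where
  "halfspace_ge v d = {x. v \<bullet> x \<ge> d}"

definition halfspace_le :: "real^2 \<Rightarrow> real \<Rightarrow> (real^2) set" where
  "halfspace_le v d = {x. v \<bullet> x \<le> d}"

text \<open>
  Vertices and edges of a triangle are labelled by the elements \<open>0, 1, 2\<close> of the type \<open>3\<close>; the edge
  labelled \<open>i\<close> is the one opposite to the vertex \<open>\<mu> i\<close>.
\<close>

definition edge_lines :: "(3 \<Rightarrow> real^2) \<Rightarrow> (3 \<Rightarrow> real^2) \<Rightarrow> (3 \<Rightarrow> real) \<Rightarrow> bool" where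
  "edge_lines \<mu> v d \<longleftrightarrow>
     (\<forall>i. v i \<noteq> 0 \<and> \<mu> i \<notin> hyperplane (v i) (d i) \<and>
          (\<forall>l. l \<noteq> i \<longrightarrow> \<mu> l \<in> hyperplane (v i) (d i))) \<and>
     convex hull (range \<mu>) = (\<Inter>i. halfspace_ge (v i) (d i))"

definition P_plus ::
  "(3 \<Rightarrow> real^2) \<Rightarrow> (3 \<Rightarrow> real^2) \<Rightarrow> (3 \<Rightarrow> real) \<Rightarrow> 3 \<Rightarrow> 3 \<Rightarrow> (real^2) set" where
  "P_plus \<mu> v d i j =
     (\<Inter>l\<in>{l. l \<noteq> i}. halfspace_ge (v l) (d l)) \<inter> halfspace_le (v i) (d i) \<inter>
     halfspace_le (v j) (v j \<bullet> \<mu> j)"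

definition normalizes :: "real^2^2 \<Rightarrow> real^2 \<Rightarrow> real^2 \<Rightarrow> real^2 \<Rightarrow> bool" where
  "normalizes M p q r \<longleftrightarrow>
     invertible M \<and> M *v (q - p) = axis 1 1 \<and> M *v (r - p) = axis 2 1"

text \<open>
  The last four inequalities are not invariant under permuting the vertices of the triangle. They
  are meant for a labelling adapted to the pair \<open>(i, j)\<close> with
  \<open>\<alpha> $ 4 \<in> interior (P_plus \<mu> v d j i)\<close> and \<open>\<alpha> $ 5 \<in> interior (P_plus \<mu> v d i j)\<close>: the
  normalization sends \<open>\<mu> j\<close> to \<open>e\<^sub>1\<close>, \<open>\<mu> i\<close> to \<open>e\<^sub>2\<close> and the third vertex to the origin. With a
  labelling fixed independently of \<open>(i, j)\<close>, the characterization of two critical points fails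
  in both directions. For instance, let the vertices \<open>\<mu> 0, \<mu> 1, \<mu> 2\<close> be \<open>(0,0), (1,0), (0,1)\<close>
  and use them as coordinates: for \<open>\<alpha> $ 4 = (3/5, 999/2000)\<close>, \<open>\<alpha> $ 5 = (-193/2000, 1333/2000)\<close>
  there are two critical points but the inequalities fail, and for \<open>\<alpha> $ 4 = (-9/5, 21/10)\<close>,
  \<open>\<alpha> $ 5 = (4/5, 2/5)\<close> they hold but there is no critical point.
\<close>

definition coordinate_inequalities :: "real^2 \<Rightarrow> real^2 \<Rightarrow> bool" where
  "coordinate_inequalities p q \<longleftrightarrow>
     (let x1 = p $ 1; y1 = p $ 2; x2 = q $ 1; y2 = q $ 2;
          a = - (x1 * y1 * (1 - x1 - y1));
          c = - (x2 * y2 * (1 - x2 - y2));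
          b = - (x1^2 * y2^2) + 2 * x1 * x2 * y1 * y2 - x2^2 * y1^2 + x1^2 * y2 + y2^2 * x1
              + x2^2 * y1 + y1^2 * x2 - x1 * y2 - x2 * y1
      in b^2 - 4 * a * c > 0 \<and>
         b^2 - 4 * a * c < (2 * x2 * y1 * (1 - x1 - y1) + b)^2 \<and>
         0 < 2 * x2 * y1 * (1 - x1 - y1) + b \<and>
         b^2 - 4 * a * c < (2 * x1 * y2 * (1 - x1 - y1) + b)^2 \<and>
         0 > 2 * x1 * y2 * (1 - x1 - y1) + b)"

end

theory Submission
  imports Defs
begin

text \<open>
  Write \<open>p i\<close> for the first column of \<open>B\<close> and \<open>z i\<close> for the entries of \<open>B *v hat \<mu>\<close>. Both \<open>p\<close> and \<open>z\<close>
  lie in the kernel of the matrix of exponents. The derivative of \<open>xi B\<close> at \<open>\<mu>\<close> is a vector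
  \<open>(g, - \<mu> g)\<close> with \<open>g = (\<Sum>i. (p i)\<^sup>2 / z i)\<close>, so critical points are the zeros of \<open>g\<close>
  (\<open>critical_points_eq\<close>).

  For the necessary condition, let \<open>\<mu>\<close> be critical. As \<open>\<Sum>i. p i\<close> and \<open>\<Sum>i. z i\<close> vanish,
  \<open>(\<Sum>i. (p i - r * z i)\<^sup>2 / z i) = g = 0\<close> for every real \<open>r\<close>. If \<open>r\<close> can be chosen
  with \<open>p i = r * z i\<close> for all \<open>i\<close> of one sign, then all remaining terms have the other sign, so they
  all vanish. Thus \<open>p = r z\<close>; the normalized last row gives \<open>r = 0\<close>, contradicting \<open>p \<noteq> 0\<close>
  (\<open>no_critical_point_if_proportional\<close>). Such an \<open>r\<close> exists when a sign class has at most one element.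
  It also exists when the class consists of the two exponents outside a collinear triple: the affine
  relation on the triple is a kernel vector \<open>B *v \<gamma>\<close>, so the rows of \<open>B\<close> at the other two exponents
  are orthogonal to \<open>\<gamma>\<close>, hence parallel. So a single critical point already forces the sign classes
  to have sizes two and three, with the larger one spanning the plane.

  For the characterization, let \<open>s\<close> and \<open>t\<close> be the barycentric coordinates of \<open>\<alpha>\<^sub>4\<close> and \<open>\<alpha>\<^sub>5\<close> in the
  triangle of positive exponents. The positive entries of a kernel vector are determined by the last
  two; in the parameter \<open>x = - z 4\<close> the domain becomes \<open>0 < x\<close>, \<open>0 < x * s l + t l\<close> and the critical
  equation becomes \<open>(\<Sum>l. s l * t l / (x * s l + t l)) = 0\<close> (\<open>card_critical_points_eq\<close>). Clearing
  denominators gives a quadratic whose leading coefficient and constant term are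
  \<open>- s 0 * s 1 * s 2\<close> and \<open>- t 0 * t 1 * t 2\<close>. Exactly two roots in the domain force all coordinates to be
  nonzero and the two products to have the same sign. Some \<open>s j\<close> and some \<open>t i\<close> must be negative,
  because the equation is equivalent to \<open>(\<Sum>l. (t l)\<^sup>2 / (x * s l + t l)) = 1\<close>, whose left-hand side
  strictly decreases in \<open>x\<close> when all \<open>s l\<close> are positive, and because \<open>x \<mapsto> 1 / x\<close> exchanges \<open>s\<close> and \<open>t\<close>.
  The same identity yields the upper bounds \<open>s i < 1\<close> and \<open>t j < 1\<close>. This is the asserted position of
  \<open>\<alpha>\<^sub>4\<close> and \<open>\<alpha>\<^sub>5\<close> (\<open>two_critical_parameters_signs\<close>). Given these signs, the domain is a bounded interval, and
  the inequalities say that the quadratic has two real roots, both between the endpoints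
  (\<open>two_critical_parameters_iff_inequalities\<close>).
\<close>

section \<open>Indices\<close>

lemma exhaust_5: "(x::5) = 1 \<or> x = 2 \<or> x = 3 \<or> x = 4 \<or> x = 5"
proof (induct x)
  case (of_int z)
  then have "0 \<le> z" and "z < 5" by simp_all
  then have "z = 0 \<or> z = 1 \<or> z = 2 \<or> z = 3 \<or> z = 4" by arith
  then show ?case by auto
qed

lemma UNIV_5: "(UNIV :: 5 set) = {1, 2, 3, 4, 5}"
  using exhaust_5 by auto

lemma sum_5: "(\<Sum>i\<in>(UNIV :: 5 set). f i) = f 1 + f 2 + f 3 + f 4 + (f 5 :: 'a :: comm_monoid_add)"
  unfolding UNIV_5 by (simp add: ac_simps)

lemma UNIV_3_eq:
  fixes i j k :: 3
  assumes "i \<noteq> j" "k \<noteq> i" "k \<noteq> j"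
  shows "UNIV = {i, j, k}"
  using assms exhaust_3[of i] exhaust_3[of j] exhaust_3[of k] UNIV_3 by auto

lemma sum_3_eq:
  fixes i j k :: 3 and f :: "3 \<Rightarrow> 'a :: comm_monoid_add"
  assumes "i \<noteq> j" "k \<noteq> i" "k \<noteq> j"
  shows "(\<Sum>l\<in>UNIV. f l) = f i + f j + f k"
  unfolding UNIV_3_eq[OF assms] using assms by (simp add: ac_simps)

lemma range_3_eq:
  fixes i j k :: 3
  assumes "i \<noteq> j" "k \<noteq> i" "k \<noteq> j"
  shows "range f = {f i, f j, f k}"
  unfolding UNIV_3_eq[OF assms] by simp

lemma exhaust_012: "(l::3) = 0 \<or> l = 1 \<or> l = 2"
  using UNIV_3_eq[of "0::3" 1 2] by auto

section \<open>The kernel of the exponent matrix\<close>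

lemma hat_matrix_kernel:
  "hat_matrix \<alpha> *v x = 0 \<longleftrightarrow> (\<Sum>i\<in>UNIV. x $ i) = 0 \<and> (\<Sum>i\<in>UNIV. x $ i *\<^sub>R \<alpha> $ i) = 0"
  by (auto simp: vec_eq_iff forall_3 forall_2 hat_matrix_def matrix_vector_mult_def mult.commute)

lemma B_hat: "(B *v hat \<mu>) $ i = B $ i $ 1 * \<mu> + B $ i $ 2"
  by (simp add: matrix_vector_mult_def sum_2 hat_def)

lemma gale_dual_kernel:
  assumes "gale_dual \<alpha> B"
  shows "hat_matrix \<alpha> *v x = 0 \<longleftrightarrow> (\<exists>\<gamma>. x = B *v \<gamma>)"
proof -
  have "span (columns B) = range ((*v) B)"
  proof
    show "span (columns B) \<subseteq> range ((*v) B)"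
      by (rule span_minimal)
        (auto simp: columns_image_basis intro: linear_subspace_image[OF matrix_vector_mul_linear])
    show "range ((*v) B) \<subseteq> span (columns B)"
      by (auto intro: matrix_vector_mult_in_columnspace)
  qed
  then show ?thesis
    using assms by (auto simp: gale_dual_def)
qed

lemma gale_dual_col_sums:
  assumes "gale_dual \<alpha> B"
  shows "(\<Sum>i\<in>UNIV. B $ i $ k) = 0"
proof -
  have "hat_matrix \<alpha> *v (B *v axis k 1) = 0"
    using gale_dual_kernel[OF assms] by blast
  then show ?thesis
    by (simp add: hat_matrix_kernel matrix_vector_mult_basis column_def)
qed

lemma gale_dual_first_column_nonzero:
  assumes "gale_dual \<alpha> B"
  shows "\<exists>i. B $ i $ 1 \<noteq> 0"
proof (rule ccontr)
  assume "\<not> ?thesis"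
  then have "column 1 B = 0"
    by (simp add: column_def vec_eq_iff)
  then have "0 \<in> columns B"
    by (auto simp: columns_def intro: exI[of _ 1])
  then show False
    using assms dependent_zero by (auto simp: gale_dual_def)
qed

section \<open>The critical equation\<close>

lemma xi_dom_nonzero:
  assumes "\<mu> \<in> xi_dom B \<epsilon>" and "\<And>i. \<epsilon> $ i \<in> {1, -1}"
  shows "(B *v hat \<mu>) $ i \<noteq> 0"
proof -
  have "sgn ((B *v hat \<mu>) $ i) = \<epsilon> $ i"
    using assms(1) by (auto simp: xi_dom_def vec_eq_iff)
  then show ?thesis
    using assms(2)[of i] by auto
qed

lemma xi_has_vector_derivative:
  assumes nz: "\<And>i. (B *v hat \<mu>) $ i \<noteq> 0"
  shows "(xi B has_vector_derivative (\<Sum>i\<in>UNIV. (B $ i $ 1 / (B *v hat \<mu>) $ i) *\<^sub>R B $ i)) (at \<mu>)"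
proof -
  have xi_sum: "xi B = (\<lambda>\<mu>. \<Sum>i\<in>UNIV. ln (B $ i $ 1 * \<mu> + B $ i $ 2) *\<^sub>R B $ i)"
  proof
    fix \<nu>
    have "ln \<bar>y\<bar> = ln y" for y :: real
      by (simp add: abs_if ln_minus)
    then show "xi B \<nu> = (\<Sum>i\<in>UNIV. ln (B $ i $ 1 * \<nu> + B $ i $ 2) *\<^sub>R B $ i)"
      unfolding xi_def B_hat
      by (simp add: vec_eq_iff matrix_vector_mult_def transpose_def mult.commute)
  qed
  have "((\<lambda>\<mu>. ln (B $ i $ 1 * \<mu> + B $ i $ 2)) has_real_derivative
      B $ i $ 1 / (B *v hat \<mu>) $ i) (at \<mu>)" for i
  proof (cases "(B *v hat \<mu>) $ i > 0")
    case True
    then show ?thesis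
      by (auto simp: B_hat intro!: derivative_eq_intros)
  next
    case False
    with nz[of i] have "- (B $ i $ 1 * \<mu> + B $ i $ 2) > 0"
      by (simp add: B_hat)
    then have "((\<lambda>\<mu>. ln (- (B $ i $ 1 * \<mu> + B $ i $ 2))) has_real_derivative
        B $ i $ 1 / (B *v hat \<mu>) $ i) (at \<mu>)"
      by (auto simp: B_hat field_simps intro!: derivative_eq_intros)
    then show ?thesis
      by (simp only: ln_minus)
  qed
  then have "((\<lambda>\<mu>. ln (B $ i $ 1 * \<mu> + B $ i $ 2) *\<^sub>R B $ i) has_vector_derivative
      (B $ i $ 1 / (B *v hat \<mu>) $ i) *\<^sub>R B $ i) (at \<mu>)" for i
    using has_vector_derivative_scaleR[OF _ has_vector_derivative_const] by fastforce
  then show ?thesis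
    unfolding xi_sum by (rule has_vector_derivative_sum)
qed

text \<open>
  The two components \<open>D\<^sub>1, D\<^sub>2\<close> of the derivative satisfy \<open>\<mu> * D\<^sub>1 + D\<^sub>2 = 0\<close>, since the combination
  cancels the denominators and leaves a column sum of \<open>B\<close>. So the first component decides.
\<close>

lemma critical_points_eq:
  assumes gd: "gale_dual \<alpha> B" and signs: "\<And>i. \<epsilon> $ i \<in> {1, -1}"
  shows "critical_points B \<epsilon> =
    {\<mu> \<in> xi_dom B \<epsilon>. (\<Sum>i\<in>UNIV. (B $ i $ 1)\<^sup>2 / (B *v hat \<mu>) $ i) = 0}"
proof -
  have "(xi B has_vector_derivative 0) (at \<mu>) \<longleftrightarrow>
      (\<Sum>i\<in>UNIV. (B $ i $ 1)\<^sup>2 / (B *v hat \<mu>) $ i) = 0" if "\<mu> \<in> xi_dom B \<epsilon>" for \<mu>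
  proof -
    have nz: "(B *v hat \<mu>) $ i \<noteq> 0" for i
      using xi_dom_nonzero[OF that signs] .
    let ?D = "\<Sum>i\<in>UNIV. (B $ i $ 1 / (B *v hat \<mu>) $ i) *\<^sub>R B $ i"
    have D1: "?D $ 1 = (\<Sum>i\<in>UNIV. (B $ i $ 1)\<^sup>2 / (B *v hat \<mu>) $ i)"
      by (simp add: sum_component power2_eq_square)
    have "\<mu> * ?D $ 1 + ?D $ 2 = (\<Sum>i\<in>UNIV. B $ i $ 1 / (B *v hat \<mu>) $ i * (B $ i $ 1 * \<mu> + B $ i $ 2))"
      by (simp add: sum_component sum_distrib_left sum.distrib[symmetric] distrib_left mult_ac)
    also have "\<dots> = (\<Sum>i\<in>UNIV. B $ i $ 1)"
      using nz by (intro sum.cong) (auto simp: B_hat)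
    finally have "\<mu> * ?D $ 1 + ?D $ 2 = 0"
      by (simp add: gale_dual_col_sums[OF gd])
    then have "?D = 0 \<longleftrightarrow> ?D $ 1 = 0"
      by (auto simp: vec_eq_iff forall_2)
    moreover have "(xi B has_vector_derivative 0) (at \<mu>) \<longleftrightarrow> ?D = 0"
      using xi_has_vector_derivative[OF nz] vector_derivative_unique_at by fastforce
    ultimately show ?thesis
      by (simp only: D1)
  qed
  then show ?thesis
    by (auto simp: critical_points_def)
qed

section \<open>The supports that admit a critical point\<close>

text \<open>
  Replacing \<open>p\<close> by \<open>p - r z\<close> leaves \<open>\<Sum>i. (p i)\<^sup>2 / z i\<close> unchanged, because \<open>p\<close> and \<open>z\<close> have zero sum.
  After the replacement the terms of sign \<open>\<sigma>\<close> are gone, so a vanishing sum of terms of the other sign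
  remains.
\<close>

lemma no_critical_point_if_proportional:
  assumes gd: "gale_dual \<alpha> B" and B5: "B $ 5 = vector [0, -1]"
    and signs: "\<And>i. \<epsilon> $ i \<in> {1, -1}" and \<mu>: "\<mu> \<in> critical_points B \<epsilon>"
    and \<sigma>: "\<sigma> \<in> {1, -1}"
    and ratio: "\<And>i. \<epsilon> $ i = \<sigma> \<Longrightarrow> B $ i $ 1 = r * (B *v hat \<mu>) $ i"
  shows False
proof -
  define z where "z i = (B *v hat \<mu>) $ i" for i
  define p where "p i = B $ i $ 1" for i
  have sgn_z: "sgn (z i) = \<epsilon> $ i" for i
    using \<mu> by (auto simp: critical_points_def xi_dom_def z_def vec_eq_iff)
  have nz: "z i \<noteq> 0" for i
    using sgn_z[of i] signs[of i] by auto
  have zero: "(\<Sum>i\<in>UNIV. (p i)\<^sup>2 / z i) = 0"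
    using \<mu> critical_points_eq[OF gd signs] by (auto simp: p_def z_def)
  have sum_p: "(\<Sum>i\<in>UNIV. p i) = 0"
    using gale_dual_col_sums[OF gd] by (simp add: p_def)
  have sum_z: "(\<Sum>i\<in>UNIV. z i) = 0"
    by (simp add: z_def B_hat sum.distrib gale_dual_col_sums[OF gd] flip: sum_distrib_right)
  have "(\<Sum>i\<in>UNIV. (p i - r * z i)\<^sup>2 / z i) =
      (\<Sum>i\<in>UNIV. (p i)\<^sup>2 / z i - 2 * r * p i + r\<^sup>2 * z i)"
    using nz by (intro sum.cong) (auto simp: power2_eq_square field_simps)
  also have "\<dots> = 0"
    by (simp add: sum.distrib sum_subtractf zero sum_p sum_z flip: sum_distrib_left)
  finally have "(\<Sum>i\<in>UNIV. (- \<sigma>) * ((p i - r * z i)\<^sup>2 / z i)) = 0"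
    by (simp only: flip: sum_distrib_left)
  moreover have "0 \<le> (- \<sigma>) * ((p i - r * z i)\<^sup>2 / z i)" for i
  proof (cases "\<epsilon> $ i = \<sigma>")
    case True
    then show ?thesis
      using ratio by (simp add: p_def z_def)
  next
    case False
    then have "\<sigma> = - sgn (z i)"
      using \<sigma> signs[of i] sgn_z[of i] by auto
    then show ?thesis
      by (auto simp: sgn_if zero_le_divide_iff divide_le_0_iff)
  qed
  ultimately have "\<forall>i\<in>UNIV. (- \<sigma>) * ((p i - r * z i)\<^sup>2 / z i) = 0"
    by (subst (asm) sum_nonneg_eq_0_iff) auto
  then have eq: "p i = r * z i" for i
    using nz[of i] \<sigma> by auto
  have "r = 0"
    using eq[of 5] B5 by (simp add: p_def z_def B_hat)
  then show False
    using eq gale_dual_first_column_nonzero[OF gd] by (auto simp: p_def)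
qed

text \<open>
  The ratio depends only on \<open>\<gamma>1, \<gamma>2, m\<close>. So all rows \<open>(p, q)\<close> orthogonal to the same nonzero vector share
  one ratio between \<open>p\<close> and \<open>p * m + q\<close>.
\<close>

lemma parallel_rows_proportional:
  fixes p q m \<gamma>1 \<gamma>2 :: real
  assumes "\<gamma>1 * p + \<gamma>2 * q = 0" "p * m + q \<noteq> 0" "\<gamma>1 \<noteq> 0 \<or> \<gamma>2 \<noteq> 0"
  shows "p = \<gamma>2 / (m * \<gamma>2 - \<gamma>1) * (p * m + q)"
proof -
  have e: "(p * m + q) * \<gamma>2 = p * (m * \<gamma>2 - \<gamma>1)"
    using assms(1) by (simp add: algebra_simps)
  have "m * \<gamma>2 - \<gamma>1 \<noteq> 0"
    using e assms by auto
  with e show ?thesis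
    by (simp add: field_simps)
qed

lemma collinear_support_relation:
  fixes \<alpha> :: "real^2^5"
  assumes col: "collinear {\<alpha> $ i, \<alpha> $ j, \<alpha> $ k}" and inj: "inj (\<lambda>i. \<alpha> $ i)"
    and "i \<noteq> j" "j \<noteq> k" "i \<noteq> k"
  obtains x where "hat_matrix \<alpha> *v x = 0" "x \<noteq> 0" "\<And>l. l \<notin> {i, j, k} \<Longrightarrow> x $ l = 0"
proof -
  have "\<alpha> $ i \<noteq> \<alpha> $ k"
    using inj \<open>i \<noteq> k\<close> by (auto dest: injD)
  then obtain u where u: "\<alpha> $ j = u *\<^sub>R \<alpha> $ i + (1 - u) *\<^sub>R \<alpha> $ k"
    using col by (auto simp: collinear_3_expand)
  define x :: "real^5" where "x = axis j 1 - axis i u - axis k (1 - u)"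
  have axis_sum: "(\<Sum>l\<in>UNIV. axis m c $ l *\<^sub>R f l) = c *\<^sub>R f m" for m :: 5 and c :: real and f :: "5 \<Rightarrow> real^2"
    by (simp add: axis_def if_distrib if_distribR cong: if_cong)
  have axis_sum': "(\<Sum>l\<in>UNIV. axis m c $ l) = c" for m :: 5 and c :: real
    by (simp add: axis_def)
  have "hat_matrix \<alpha> *v x = 0"
    by (simp add: hat_matrix_kernel x_def sum_subtractf scaleR_left_diff_distrib axis_sum axis_sum' u)
  moreover have "x $ j = 1"
    using assms by (simp add: x_def axis_def)
  then have "x \<noteq> 0"
    by auto
  moreover have "x $ l = 0" if "l \<notin> {i, j, k}" for l
    using that by (simp add: x_def axis_def)
  ultimately show thesis
    using that by blast
qed

text \<open>
  The affine relation between the collinear exponents makes the rows of \<open>B\<close> at all exponents of the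
  opposite sign parallel, so that \<open>p\<close> and \<open>z\<close> are proportional there.
\<close>

lemma no_critical_point_if_collinear:
  assumes gd: "gale_dual \<alpha> B" and B5: "B $ 5 = vector [0, -1]"
    and signs: "\<And>i. \<epsilon> $ i \<in> {1, -1}" and \<mu>: "\<mu> \<in> critical_points B \<epsilon>"
    and inj: "inj (\<lambda>i. \<alpha> $ i)" and \<sigma>: "\<sigma> \<in> {1, -1}"
    and ijk: "{l. \<epsilon> $ l = \<sigma>} = {i, j, k}" "i \<noteq> j" "j \<noteq> k" "i \<noteq> k"
    and col: "collinear {\<alpha> $ i, \<alpha> $ j, \<alpha> $ k}"
  shows False
proof -
  obtain x where x: "hat_matrix \<alpha> *v x = 0" "x \<noteq> 0" "\<And>l. l \<notin> {i, j, k} \<Longrightarrow> x $ l = 0"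
    using collinear_support_relation[OF col inj ijk(2-4)] by metis
  then obtain \<gamma> where \<gamma>: "x = B *v \<gamma>"
    using gale_dual_kernel[OF gd] by auto
  have \<gamma>0: "\<gamma> $ 1 \<noteq> 0 \<or> \<gamma> $ 2 \<noteq> 0"
    using \<open>x \<noteq> 0\<close> by (auto simp: \<gamma> vec_eq_iff matrix_vector_mult_def sum_2)
  show False
  proof (rule no_critical_point_if_proportional[OF gd B5 signs \<mu>])
    show "- \<sigma> \<in> {1, - 1}"
      using \<sigma> by auto
    fix l
    assume "\<epsilon> $ l = - \<sigma>"
    then have "l \<notin> {i, j, k}"
      using \<sigma> unfolding ijk(1)[symmetric] by auto
    then have "\<gamma> $ 1 * B $ l $ 1 + \<gamma> $ 2 * B $ l $ 2 = 0"
      using x(3)[of l] by (simp add: \<gamma> matrix_vector_mult_def sum_2 mult.commute)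
    moreover have "B $ l $ 1 * \<mu> + B $ l $ 2 \<noteq> 0"
      using xi_dom_nonzero[OF _ signs, of _ B l] \<mu> by (auto simp: critical_points_def B_hat)
    ultimately show "B $ l $ 1 = \<gamma> $ 2 / (\<mu> * \<gamma> $ 2 - \<gamma> $ 1) * (B *v hat \<mu>) $ l"
      using parallel_rows_proportional[OF _ _ \<gamma>0] by (simp add: B_hat)
  qed
qed

text \<open>
  If at most one entry of \<open>z\<close> has sign \<open>\<sigma>\<close>, then \<open>p\<close> and \<open>z\<close> are trivially proportional on that class.
\<close>

lemma critical_point_sign_class:
  assumes gd: "gale_dual \<alpha> B" and B5: "B $ 5 = vector [0, -1]"
    and signs: "\<And>i. \<epsilon> $ i \<in> {1, -1}" and \<mu>: "\<mu> \<in> critical_points B \<epsilon>" and \<sigma>: "\<sigma> \<in> {1, -1}"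
  shows "2 \<le> card {i. \<epsilon> $ i = \<sigma>}"
proof (rule ccontr)
  assume "\<not> ?thesis"
  then have "card {i. \<epsilon> $ i = \<sigma>} \<le> Suc 0"
    by simp
  then have single: "i = j" if "\<epsilon> $ i = \<sigma>" "\<epsilon> $ j = \<sigma>" for i j
    using that by (auto simp: card_le_Suc0_iff_eq)
  have "\<exists>r. \<forall>i. \<epsilon> $ i = \<sigma> \<longrightarrow> B $ i $ 1 = r * (B *v hat \<mu>) $ i"
  proof (cases "\<exists>i. \<epsilon> $ i = \<sigma>")
    case True
    then obtain i where i: "\<epsilon> $ i = \<sigma>" by blast
    have "(B *v hat \<mu>) $ i \<noteq> 0"
      using xi_dom_nonzero[OF _ signs] \<mu> by (auto simp: critical_points_def)
    then show ?thesis
      using single[OF _ i] by (intro exI[of _ "B $ i $ 1 / (B *v hat \<mu>) $ i"]) force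
  qed auto
  then show False
    using no_critical_point_if_proportional[OF gd B5 signs \<mu> \<sigma>] by blast
qed

lemma critical_point_support:
  assumes gd: "gale_dual \<alpha> B" and B5: "B $ 5 = vector [0, -1]"
    and ss: "signed_support \<alpha> \<epsilon>" and \<mu>: "\<mu> \<in> critical_points B \<epsilon>"
  shows "card (pos_support \<alpha> \<epsilon>) = 3 \<and> card (neg_support \<alpha> \<epsilon>) = 2 \<and>
          aff_dim (convex hull (pos_support \<alpha> \<epsilon>)) = 2
      \<or> card (pos_support \<alpha> \<epsilon>) = 2 \<and> card (neg_support \<alpha> \<epsilon>) = 3 \<and>
          aff_dim (convex hull (neg_support \<alpha> \<epsilon>)) = 2"
proof -
  have signs: "\<epsilon> $ i \<in> {1, -1}" for i
    using ss by (auto simp: signed_support_def)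
  have inj: "inj (\<lambda>i. \<alpha> $ i)"
    using ss by (auto simp: signed_support_def)
  let ?I = "\<lambda>\<sigma>. {i. \<epsilon> $ i = \<sigma>}"
  let ?S = "\<lambda>\<sigma>. (\<lambda>i. \<alpha> $ i) ` ?I \<sigma>"
  have supp: "pos_support \<alpha> \<epsilon> = ?S 1" "neg_support \<alpha> \<epsilon> = ?S (-1)"
    by (auto simp: pos_support_def neg_support_def)
  have card: "card (?S \<sigma>) = card (?I \<sigma>)" for \<sigma>
    using inj by (intro card_image) (auto intro: inj_on_subset)
  have "card (?I 1 \<union> ?I (-1)) = card (?I 1) + card (?I (-1))"
    by (intro card_Un_disjoint) auto
  moreover have "?I 1 \<union> ?I (-1) = UNIV"
    using signs by auto
  ultimately have "card (?I 1) + card (?I (-1)) = 5"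
    by simp
  moreover have "2 \<le> card (?I 1)" "2 \<le> card (?I (-1))"
    using critical_point_sign_class[OF gd B5 signs \<mu>] by auto
  moreover have "aff_dim (convex hull (?S \<sigma>)) = 2" if \<sigma>: "\<sigma> \<in> {1, -1}" and c: "card (?I \<sigma>) = 3" for \<sigma>
  proof -
    obtain i j k where ijk: "?I \<sigma> = {i, j, k}" "i \<noteq> j" "j \<noteq> k" "i \<noteq> k"
      using c by (auto simp: card_3_iff)
    have "\<not> collinear (?S \<sigma>)"
      using no_critical_point_if_collinear[OF gd B5 signs \<mu> inj \<sigma> ijk] by (auto simp: ijk(1))
    moreover have "aff_dim (?S \<sigma>) \<le> 2"
      using aff_dim_le_card[of "?S \<sigma>"] card[of \<sigma>] c by simp
    ultimately show ?thesis
      by (auto simp: collinear_aff_dim aff_dim_convex_hull)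
  qed
  ultimately show ?thesis
    unfolding supp card by force
qed

section \<open>The critical equation in barycentric coordinates\<close>

text \<open>
  Here \<open>s\<close> and \<open>t\<close> stand for the barycentric coordinates of the two negative exponents with respect to
  the positive ones; a parameter \<open>x\<close> corresponds to the kernel vector with entries \<open>x * s l + t l\<close> at
  the positive exponents and \<open>- x\<close>, \<open>- 1\<close> at the negative ones.
\<close>

definition critical_parameters :: "(3 \<Rightarrow> real) \<Rightarrow> (3 \<Rightarrow> real) \<Rightarrow> real set" where
  "critical_parameters s t =
    {x. 0 < x \<and> (\<forall>l. 0 < x * s l + t l) \<and> (\<Sum>l\<in>UNIV. s l * t l / (x * s l + t l)) = 0}"

text \<open>
  In terms of all barycentric coordinates this is
  \<open>- (\<Sum>l. s l * t l * (s l' * t l'' + s l'' * t l'))\<close>, where \<open>l'\<close> and \<open>l''\<close> are the other two labels,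
  with the coordinates at one label eliminated.
\<close>

definition middle_coeff :: "real \<Rightarrow> real \<Rightarrow> real \<Rightarrow> real \<Rightarrow> real" where
  "middle_coeff x1 y1 x2 y2 = - (x1^2 * y2^2) + 2 * x1 * x2 * y1 * y2 - x2^2 * y1^2 + x1^2 * y2
    + y2^2 * x1 + x2^2 * y1 + y1^2 * x2 - x1 * y2 - x2 * y1"

lemma critical_equation_quadratic:
  fixes x1 y1 w1 x2 y2 w2 m :: real
  assumes "x1 + y1 + w1 = 1" "x2 + y2 + w2 = 1"
    and nz: "m * x1 + x2 \<noteq> 0" "m * y1 + y2 \<noteq> 0" "m * w1 + w2 \<noteq> 0"
  shows "y1 * y2 / (m * y1 + y2) + x1 * x2 / (m * x1 + x2) + w1 * w2 / (m * w1 + w2) = 0 \<longleftrightarrow>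
    - (x1 * y1 * w1) * m^2 + middle_coeff x1 y1 x2 y2 * m - x2 * y2 * w2 = 0"
proof -
  have w: "w1 = 1 - x1 - y1" "w2 = 1 - x2 - y2"
    using assms by auto
  have "y1 * y2 * (m * x1 + x2) * (m * w1 + w2) + x1 * x2 * (m * y1 + y2) * (m * w1 + w2)
      + w1 * w2 * (m * y1 + y2) * (m * x1 + x2)
      = - (- (x1 * y1 * w1) * m^2 + middle_coeff x1 y1 x2 y2 * m - x2 * y2 * w2)"
    unfolding w middle_coeff_def by algebra
  moreover have "y1 * y2 / (m * y1 + y2) + x1 * x2 / (m * x1 + x2) + w1 * w2 / (m * w1 + w2) =
      (y1 * y2 * (m * x1 + x2) * (m * w1 + w2) + x1 * x2 * (m * y1 + y2) * (m * w1 + w2)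
      + w1 * w2 * (m * y1 + y2) * (m * x1 + x2)) / ((m * y1 + y2) * (m * x1 + x2) * (m * w1 + w2))"
    using nz by (simp add: divide_simps) algebra
  ultimately show ?thesis
    using nz by auto
qed

lemma critical_parameters_quadratic:
  assumes ijk: "i \<noteq> j" "k \<noteq> i" "k \<noteq> j" and st: "sum s UNIV = 1" "sum t UNIV = 1"
  shows "m \<in> critical_parameters s t \<longleftrightarrow> 0 < m \<and> (\<forall>l. 0 < m * s l + t l) \<and>
    - (s j * s i * s k) * m^2 + middle_coeff (s j) (s i) (t j) (t i) * m - t j * t i * t k = 0"
proof -
  have "(\<Sum>l\<in>UNIV. s l * t l / (m * s l + t l)) = 0 \<longleftrightarrow>
      - (s j * s i * s k) * m^2 + middle_coeff (s j) (s i) (t j) (t i) * m - t j * t i * t k = 0"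
    if "\<forall>l. 0 < m * s l + t l"
    unfolding sum_3_eq[OF ijk]
    using st that by (intro critical_equation_quadratic) (auto simp: sum_3_eq[OF ijk] less_imp_neq[symmetric] algebra_simps)
  then show ?thesis
    by (auto simp: critical_parameters_def)
qed

text \<open>
  If the leading coefficient vanished, the two roots would force the zero polynomial; then their
  midpoint, which lies in the convex domain, would be a third root. The other conclusions are Vieta's
  formulas.
\<close>

lemma two_critical_parameters:
  assumes ijk: "i \<noteq> j" "k \<noteq> i" "k \<noteq> j" and st: "sum s UNIV = 1" "sum t UNIV = 1"
    and card: "card (critical_parameters s t) = 2"
  obtains m n where "critical_parameters s t = {m, n}" "0 < m" "m < n" "s j * s i * s k \<noteq> 0"
    "middle_coeff (s j) (s i) (t j) (t i) = (s j * s i * s k) * (m + n)"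
    "t j * t i * t k = (s j * s i * s k) * (m * n)"
proof -
  obtain m n where mn: "critical_parameters s t = {m, n}" "m < n"
    using card by (metis card_2_iff doubleton_eq_iff linorder_neqE_linordered_idom)
  define A b C where "A = s j * s i * s k" and "b = middle_coeff (s j) (s i) (t j) (t i)" and "C = t j * t i * t k"
  note iff = critical_parameters_quadratic[OF ijk st, folded A_def b_def C_def]
  have m: "0 < m" "\<forall>l. 0 < m * s l + t l" "- A * m^2 + b * m - C = 0"
    and n: "0 < n" "\<forall>l. 0 < n * s l + t l" "- A * n^2 + b * n - C = 0"
    using iff[of m] iff[of n] mn by auto
  have "(n - m) * (b - A * (m + n)) = 0"
    using m(3) n(3) by algebra
  then have b: "b = A * (m + n)"
    using mn by simp
  have C: "C = A * (m * n)"
    using m(3) b by algebra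
  have "A \<noteq> 0"
  proof
    assume "A = 0"
    have "0 < (m + n) / 2 * s l + t l" for l
      using m(2)[rule_format, of l] n(2)[rule_format, of l] by (simp add: field_simps)
    then have "(m + n) / 2 \<in> critical_parameters s t"
      using m n b C \<open>A = 0\<close> by (simp add: iff)
    then show False
      using mn by auto
  qed
  then show thesis
    using that[of m n] mn m b C by (auto simp: A_def b_def C_def)
qed

text \<open>
  Exchanging the roles of the two negative exponents rescales the kernel vector by \<open>1 / x\<close>.
\<close>

lemma critical_parameters_swap:
  "critical_parameters t s = inverse ` critical_parameters s t"
proof -
  have sub: "inverse ` critical_parameters s t \<subseteq> critical_parameters t s" for s t
  proof
    fix y assume "y \<in> inverse ` critical_parameters s t"
    then obtain x where y: "y = inverse x" and x: "0 < x" "\<And>l. 0 < x * s l + t l"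
      "(\<Sum>l\<in>UNIV. s l * t l / (x * s l + t l)) = 0"
      by (auto simp: critical_parameters_def)
    have e: "y * t l + s l = (x * s l + t l) / x" for l
      using x(1) by (simp add: y field_simps)
    have "(\<Sum>l\<in>UNIV. t l * s l / (y * t l + s l)) = x * (\<Sum>l\<in>UNIV. s l * t l / (x * s l + t l))"
      unfolding e sum_distrib_left by (intro sum.cong) (simp_all add: mult_ac)
    then show "y \<in> critical_parameters t s"
      using x e by (auto simp: critical_parameters_def y)
  qed
  show ?thesis
    using sub[of s t] image_mono[OF sub[of t s], of inverse] by (force simp: image_image)
qed

text \<open>
  Termwise, \<open>(t l)\<^sup>2 = t l * (x * s l + t l) - x * (s l * t l)\<close>. In contrast to the original equation,
  all terms of this form are nonnegative, so it can be used for estimates.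
\<close>

lemma critical_parameters_squares:
  assumes x: "x \<in> critical_parameters s t" and t: "sum t UNIV = 1"
  shows "(\<Sum>l\<in>UNIV. (t l)\<^sup>2 / (x * s l + t l)) = 1"
proof -
  have "(t l)\<^sup>2 / (x * s l + t l) = t l - x * (s l * t l / (x * s l + t l))" for l
  proof -
    have "x * s l + t l \<noteq> 0"
      using x by (auto simp: critical_parameters_def less_imp_neq[symmetric])
    then show ?thesis
      by (simp add: field_simps power2_eq_square)
  qed
  then have "(\<Sum>l\<in>UNIV. (t l)\<^sup>2 / (x * s l + t l)) =
      sum t UNIV - x * (\<Sum>l\<in>UNIV. s l * t l / (x * s l + t l))"
    by (simp only: sum_subtractf sum_distrib_left)
  then show ?thesis
    using x t by (simp add: critical_parameters_def)
qed

text \<open>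
  With positive \<open>s\<close>, the sum of \<open>(t l)\<^sup>2 / (x * s l + t l)\<close> strictly decreases in \<open>x\<close>, so it takes the
  value \<open>1\<close> at most once.
\<close>

lemma all_positive_critical_parameters_unique:
  assumes t: "sum t UNIV = 1" and pos: "\<And>l. 0 < s l" and nz: "\<And>l. t l \<noteq> 0"
    and xy: "x \<in> critical_parameters s t" "y \<in> critical_parameters s t"
  shows "x = y"
proof -
  have less: False if "x < y" "x \<in> critical_parameters s t" "y \<in> critical_parameters s t" for x y
  proof -
    have "(\<Sum>l\<in>UNIV. (t l)\<^sup>2 / (y * s l + t l)) < (\<Sum>l\<in>UNIV. (t l)\<^sup>2 / (x * s l + t l))"
    proof (rule sum_strict_mono)
      fix l
      have "0 < x * s l + t l" "x * s l < y * s l"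
        using that pos by (auto simp: critical_parameters_def)
      then show "(t l)\<^sup>2 / (y * s l + t l) < (t l)\<^sup>2 / (x * s l + t l)"
        using nz by (intro divide_strict_left_mono) auto
    qed auto
    then show False
      using critical_parameters_squares[OF _ t] that by auto
  qed
  show ?thesis
    using less[of x y] less[of y x] xy by (cases x y rule: linorder_cases) auto
qed

text \<open>
  If \<open>t i \<ge> 1\<close>, the denominator \<open>x * s i + t i\<close> is below \<open>t i\<close>, and the term at \<open>i\<close> alone exceeds the
  value \<open>1\<close> of the sum of \<open>(t l)\<^sup>2 / (x * s l + t l)\<close>.
\<close>

lemma positive_coordinate_less_1:
  assumes x: "x \<in> critical_parameters s t" and t: "sum t UNIV = 1" and "s i < 0"
  shows "t i < 1"
proof (rule ccontr)
  assume "\<not> t i < 1"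
  have pos: "0 < x" "0 < x * s l + t l" for l
    using x by (auto simp: critical_parameters_def)
  have "x * s i + t i < t i"
    using pos(1) \<open>s i < 0\<close> by (simp add: mult_pos_neg)
  also have "\<dots> \<le> (t i)\<^sup>2"
    using \<open>\<not> t i < 1\<close> by (simp add: power2_eq_square mult_le_cancel_left1)
  finally have "1 < (t i)\<^sup>2 / (x * s i + t i)"
    using pos(2)[of i] by simp
  also have "\<dots> \<le> (\<Sum>l\<in>UNIV. (t l)\<^sup>2 / (x * s l + t l))"
    using pos(2) by (intro member_le_sum) (auto simp: less_imp_le)
  finally show False
    using critical_parameters_squares[OF x t] by simp
qed

text \<open>
  Each of \<open>s\<close> and \<open>t\<close> has a negative coordinate by uniqueness in the positive case. No coordinate is
  negative in both, since \<open>x * s l + t l\<close> is positive; the sign of the product of all six coordinates then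
  settles the third label.
\<close>

lemma two_critical_parameters_signs:
  assumes st: "sum s UNIV = 1" "sum t UNIV = 1" and card: "card (critical_parameters s t) = 2"
  obtains i j k where "i \<noteq> j" "k \<noteq> i" "k \<noteq> j" "s j < 0" "0 < s i" "s i < 1" "0 < s k"
    "t i < 0" "0 < t j" "t j < 1" "0 < t k"
proof -
  have labels: "(0::3) \<noteq> 1" "(2::3) \<noteq> 0" "(2::3) \<noteq> 1"
    by auto
  obtain m n where mn: "critical_parameters s t = {m, n}" "0 < m" "m < n"
    and s0: "s 1 * s 0 * s 2 \<noteq> 0" and t0: "t 1 * t 0 * t 2 = (s 1 * s 0 * s 2) * (m * n)"
    by (rule two_critical_parameters[OF labels st card]) blast
  have all: "P l" if "P 0" "P 1" "P 2" for P and l :: 3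
    using that exhaust_012[of l] by auto
  have "t 1 * t 0 * t 2 \<noteq> 0"
    using s0 t0 mn by simp
  then have nz: "s l \<noteq> 0" "t l \<noteq> 0" for l
    using s0 all[of "\<lambda>l. s l \<noteq> 0" l] all[of "\<lambda>l. t l \<noteq> 0" l] by simp_all
  have m: "m \<in> critical_parameters s t" and n: "n \<in> critical_parameters s t"
    using mn by auto
  have m': "inverse m \<in> critical_parameters t s" and n': "inverse n \<in> critical_parameters t s"
    using m n by (auto simp: critical_parameters_swap[of t s])
  have pos: "0 < m * s l + t l" for l
    using m by (auto simp: critical_parameters_def)
  have "\<exists>j. s j < 0"
  proof (rule ccontr)
    assume "\<not> ?thesis"
    then have "0 < s l" for l
      using nz by (metis linorder_neqE_linordered_idom)
    then show False
      using all_positive_critical_parameters_unique[OF st(2) _ nz(2) m n] mn by auto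
  qed
  then obtain j where j: "s j < 0" by blast
  have "\<exists>i. t i < 0"
  proof (rule ccontr)
    assume "\<not> ?thesis"
    then have "0 < t l" for l
      using nz by (metis linorder_neqE_linordered_idom)
    then show False
      using all_positive_critical_parameters_unique[OF st(1) _ nz(1) m' n'] mn by auto
  qed
  then obtain i where i: "t i < 0" by blast
  have one_neg: "0 < t l" if "s l < 0" for l
    using pos[of l] that mn by (smt (verit) mult_pos_neg)
  have "i \<noteq> j"
    using one_neg[OF j] i by auto
  then have "card {i, j} \<noteq> card (UNIV :: 3 set)"
    by simp
  then have "{i, j} \<noteq> UNIV"
    by metis
  then obtain k where k: "k \<noteq> i" "k \<noteq> j"
    by blast
  have "0 < t j" "0 < s i"
    using one_neg[OF j] one_neg[of i] nz(1)[of i] i by force+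
  obtain c where c: "0 < c" "t j * t i * t k = (s j * s i * s k) * c"
    by (rule two_critical_parameters[OF \<open>i \<noteq> j\<close> k st card]) (metis less_trans mult_pos_pos)
  have "(t j * - t i) * t k = (- s j * s i) * c * s k"
    using c(2) by (simp add: algebra_simps)
  moreover have "0 < t j * - t i" "0 < (- s j * s i) * c"
    using \<open>0 < t j\<close> \<open>0 < s i\<close> i j c(1) by (simp_all add: mult_pos_neg mult_neg_pos)
  ultimately have "0 < t k \<longleftrightarrow> 0 < s k"
    by (metis zero_less_mult_pos mult_pos_pos)
  then have "0 < s k" "0 < t k"
    using one_neg[of k] nz(1)[of k] by force+
  show thesis
    using that[OF \<open>i \<noteq> j\<close> k j \<open>0 < s i\<close> positive_coordinate_less_1[OF m' st(1) i] \<open>0 < s k\<close> i \<open>0 < t j\<close>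
      positive_coordinate_less_1[OF m st(2) j] \<open>0 < t k\<close>] .
qed

text \<open>
  Under these signs the domain is the interval from \<open>- t i / s i\<close> to \<open>- t j / s j\<close>. With leading coefficient
  \<open>A > 0\<close>, multiplying the roots and the endpoints by \<open>2 * A\<close> turns the position of the roots into the
  comparison of the square root of the discriminant with \<open>2 * t j * s i * s k + b\<close> and
  \<open>- (2 * s j * t i * s k + b)\<close>.
\<close>

lemma two_critical_parameters_iff_inequalities:
  fixes p q :: "real^2"
  assumes ijk: "i \<noteq> j" "k \<noteq> i" "k \<noteq> j" and st: "sum s UNIV = 1" "sum t UNIV = 1"
    and p: "p $ 1 = s j" "p $ 2 = s i" and q: "q $ 1 = t j" "q $ 2 = t i"
    and s: "s j < 0" "0 < s i" "0 < s k" and t: "t i < 0" "0 < t j" "0 < t k"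
  shows "card (critical_parameters s t) = 2 \<longleftrightarrow> coordinate_inequalities p q"
proof -
  have w: "1 - s j - s i = s k" "1 - t j - t i = t k"
    using st by (simp_all add: sum_3_eq[OF ijk])
  define A b C where "A = - (s j * s i * s k)" and "b = middle_coeff (s j) (s i) (t j) (t i)"
    and "C = - (t j * t i * t k)"
  have "0 < A"
    using s by (simp add: A_def mult_less_0_iff zero_less_mult_iff)
  have end1: "2 * t j * s i * s k * s j = - 2 * A * t j"
    and end2: "2 * s j * t i * s k * s i = - 2 * A * t i"
    by (simp_all add: A_def)
  have ineq: "coordinate_inequalities p q \<longleftrightarrow>
      b^2 - 4 * A * C > 0 \<and>
      b^2 - 4 * A * C < (2 * t j * s i * s k + b)^2 \<and> 0 < 2 * t j * s i * s k + b \<and>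
      b^2 - 4 * A * C < (2 * s j * t i * s k + b)^2 \<and> 0 > 2 * s j * t i * s k + b"
    unfolding coordinate_inequalities_def Let_def p q w A_def b_def C_def middle_coeff_def by simp
  show ?thesis
  proof
    assume card: "card (critical_parameters s t) = 2"
    obtain m n where mn: "critical_parameters s t = {m, n}" "0 < m" "m < n"
      and b: "b = - A * (m + n)" and C: "C = A * (m * n)"
      by (rule two_critical_parameters[OF ijk st card]) (simp add: A_def b_def C_def)
    have dom: "0 < m * s i + t i" "0 < n * s j + t j"
      using mn by (auto simp: critical_parameters_def set_eq_iff)
    have D: "b^2 - 4 * A * C = (A * (n - m))^2"
      unfolding b C by algebra
    have "0 < A * (n - m)"
      using \<open>0 < A\<close> mn by simp
    have "A * (n - m) < 2 * t j * s i * s k + b"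
    proof -
      have "(- s j) * (2 * t j * s i * s k + b - A * (n - m)) = 2 * A * (n * s j + t j)"
        unfolding b using end1 by (simp add: algebra_simps)
      then show ?thesis
        using dom(2) \<open>0 < A\<close> s(1) by (smt (verit) mult_pos_pos zero_less_mult_pos)
    qed
    moreover have "A * (n - m) < - (2 * s j * t i * s k + b)"
    proof -
      have "s i * (- (2 * s j * t i * s k + b) - A * (n - m)) = 2 * A * (m * s i + t i)"
        unfolding b using end2 by (simp add: algebra_simps)
      then show ?thesis
        using dom(1) \<open>0 < A\<close> s(2) by (smt (verit) mult_pos_pos zero_less_mult_pos)
    qed
    ultimately show "coordinate_inequalities p q"
      unfolding ineq D using \<open>0 < A * (n - m)\<close>
      by (smt (verit) power_strict_mono power2_minus zero_less_power pos2)
  next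
    assume "coordinate_inequalities p q"
    then have D: "b^2 - 4 * A * C > 0"
      and 1: "b^2 - 4 * A * C < (2 * t j * s i * s k + b)^2" "0 < 2 * t j * s i * s k + b"
      and 2: "b^2 - 4 * A * C < (2 * s j * t i * s k + b)^2" "0 > 2 * s j * t i * s k + b"
      unfolding ineq by auto
    define d where "d = sqrt (b^2 - 4 * A * C)"
    have d: "0 < d" "d^2 = b^2 - 4 * A * C"
      using D by (auto simp: d_def)
    have d1: "d < 2 * t j * s i * s k + b"
      using 1 d by (metis less_imp_le power_less_imp_less_base)
    have d2: "d < - (2 * s j * t i * s k + b)"
    proof (rule power_less_imp_less_base)
      show "d^2 < (- (2 * s j * t i * s k + b))^2"
        using 2(1) d(2) by (simp only: power2_minus)
    qed (use 2(2) in simp)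
    define m n where "m = (- b - d) / (2 * A)" and "n = (- b + d) / (2 * A)"
    have m: "2 * A * m = - b - d" and n: "2 * A * n = - b + d"
      using \<open>0 < A\<close> by (simp_all add: m_def n_def)
    have "m < n"
      using \<open>0 < A\<close> d(1) by (simp add: m_def n_def divide_strict_right_mono)
    have quad: "A * x^2 + b * x + C = 0 \<longleftrightarrow> x = m \<or> x = n" for x
    proof -
      have "4 * A * (A * x^2 + b * x + C) = (2 * A * x - 2 * A * m) * (2 * A * x - 2 * A * n)"
        unfolding m n using d(2) by algebra
      also have "\<dots> = 4 * A^2 * ((x - m) * (x - n))"
        by algebra
      finally show ?thesis
        using \<open>0 < A\<close> by (metis (no_types, opaque_lifting) eq_iff_diff_eq_0 mult_eq_0_iff power_not_zero
            less_numeral_extra(3) zero_neq_numeral)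
    qed
    have "2 * A * (m * s i + t i) = s i * (- (2 * s j * t i * s k + b) - d)"
      using m end2 by algebra
    then have mi: "0 < m * s i + t i"
      using d2 s(2) \<open>0 < A\<close> by (smt (verit) mult_pos_pos zero_less_mult_pos)
    have "2 * A * (n * s j + t j) = (- s j) * (2 * t j * s i * s k + b - d)"
      using n end1 by algebra
    then have nj: "0 < n * s j + t j"
      using d1 s(1) \<open>0 < A\<close> by (smt (verit) mult_pos_pos zero_less_mult_pos)
    have "0 < m * s i"
      using mi t(1) by linarith
    then have "0 < m"
      using s(2) by (simp add: zero_less_mult_iff)
    have inside: "0 < x \<and> (\<forall>l. 0 < x * s l + t l)" if "m \<le> x" "x \<le> n" for x
    proof -
      have "m * s i \<le> x * s i" "n * s j \<le> x * s j" "0 < x * s k"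
        using that s \<open>0 < m\<close> by (simp_all add: mult_right_mono mult_right_mono_neg)
      then have "0 < x * s l + t l" if "l \<in> {i, j, k}" for l
        using that mi nj t by auto
      then show ?thesis
        using UNIV_3_eq[OF ijk] \<open>0 < m\<close> that by auto
    qed
    have "critical_parameters s t = {m, n}"
      using inside[of m] inside[of n] quad \<open>m < n\<close>
      by (auto simp: critical_parameters_quadratic[OF ijk st] A_def b_def C_def)
    then show "card (critical_parameters s t) = 2"
      using \<open>m < n\<close> by simp
  qed
qed

section \<open>Coordinates relative to a triangle\<close>

lemma normalizes_exists:
  fixes p q r :: "real^2"
  assumes "aff_dim (convex hull {p, q, r}) = 2"
  shows "\<exists>M. normalizes M p q r"
proof -
  have full: "affine hull {p, q, r} = UNIV"
    using assms by (simp add: aff_dim_convex_hull flip: aff_dim_eq_full)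
  define C :: "real^2^2" where "C = (\<chi> i j. if j = 1 then (q - p) $ i else (r - p) $ i)"
  have C: "C *v x = x $ 1 *\<^sub>R (q - p) + x $ 2 *\<^sub>R (r - p)" for x
    by (simp add: C_def matrix_vector_mult_def vec_eq_iff sum_2 mult.commute)
  have "surj ((*v) C)"
  proof -
    have "\<exists>x. C *v x = y" for y
    proof -
      have "y + p \<in> affine hull {p, q, r}"
        using full by simp
      then obtain u v w where uvw: "y + p = u *\<^sub>R p + v *\<^sub>R q + w *\<^sub>R r" "u + v + w = 1"
        by (auto simp: affine_hull_3)
      have "u = 1 - v - w"
        using uvw by simp
      then have "y = (1 - v - w) *\<^sub>R p + v *\<^sub>R q + w *\<^sub>R r - p"
        using uvw(1) by (metis add_diff_cancel_right')
      then have "C *v vector [v, w] = y"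
        by (simp add: C algebra_simps)
      then show ?thesis ..
    qed
    then show ?thesis
      by (metis surjI)
  qed
  then obtain M where "C ** M = mat 1"
    by (auto simp flip: matrix_right_invertible_surjective)
  then have M: "M ** C = mat 1" "C ** M = mat 1"
    by (simp_all add: matrix_left_right_inverse)
  have "M *v (C *v x) = x" for x
    by (simp add: matrix_vector_mul_assoc M)
  from this[of "axis 1 1"] this[of "axis 2 1"]
  have "normalizes M p q r"
    using M by (auto simp: normalizes_def invertible_def C axis_def)
  then show ?thesis ..
qed

lemma barycentric_coordinates_exist:
  fixes \<mu> :: "3 \<Rightarrow> real^2"
  assumes "aff_dim (convex hull (range \<mu>)) = 2"
  obtains s where "sum s UNIV = 1" "x = (\<Sum>l\<in>UNIV. s l *\<^sub>R \<mu> l)"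
proof -
  have "range \<mu> = {\<mu> 0, \<mu> 1, \<mu> 2}"
    by (rule range_3_eq) auto
  then have "affine hull {\<mu> 0, \<mu> 1, \<mu> 2} = UNIV"
    using assms by (simp add: aff_dim_convex_hull flip: aff_dim_eq_full)
  then have "x \<in> affine hull {\<mu> 0, \<mu> 1, \<mu> 2}"
    by simp
  then obtain u v w where "x = u *\<^sub>R \<mu> 0 + v *\<^sub>R \<mu> 1 + w *\<^sub>R \<mu> 2" "u + v + w = 1"
    by (auto simp: affine_hull_3)
  then show thesis
    using that[of "\<lambda>l. if l = 0 then u else if l = 1 then v else w"]
    by (simp add: sum_3_eq[of "0::3" 1 2])
qed

text \<open>
  Stated for combinations of arbitrary total weight: weight \<open>1\<close> yields the normalized coordinates of a
  point, and weight \<open>0\<close> yields affine independence of the vertices.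
\<close>

lemma normalizes_combination:
  fixes \<mu> :: "3 \<Rightarrow> real^2"
  assumes M: "normalizes M (\<mu> k) (\<mu> j) (\<mu> i)" and ijk: "i \<noteq> j" "k \<noteq> i" "k \<noteq> j"
  shows "M *v (\<Sum>l\<in>UNIV. s l *\<^sub>R \<mu> l) + - (sum s UNIV *\<^sub>R (M *v \<mu> k)) = vector [s j, s i]"
proof -
  have "(\<Sum>l\<in>UNIV. s l *\<^sub>R \<mu> l) =
      sum s UNIV *\<^sub>R \<mu> k + s j *\<^sub>R (\<mu> j - \<mu> k) + s i *\<^sub>R (\<mu> i - \<mu> k)"
    by (simp add: sum_3_eq[OF ijk] algebra_simps)
  then have "M *v (\<Sum>l\<in>UNIV. s l *\<^sub>R \<mu> l) =
      sum s UNIV *\<^sub>R (M *v \<mu> k) + s j *\<^sub>R axis 1 1 + s i *\<^sub>R axis 2 1"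
    using M by (simp add: normalizes_def matrix_vector_right_distrib matrix_vector_mult_scaleR)
  then show ?thesis
    by (simp add: vec_eq_iff forall_2 axis_def)
qed

lemma triangle_affinely_independent:
  fixes \<mu> :: "3 \<Rightarrow> real^2"
  assumes "aff_dim (convex hull (range \<mu>)) = 2"
    and "sum u UNIV = 0" "(\<Sum>l\<in>UNIV. u l *\<^sub>R \<mu> l) = 0"
  shows "u l = 0"
proof -
  have "range \<mu> = {\<mu> 2, \<mu> 1, \<mu> 0}"
    by (rule range_3_eq) auto
  then obtain M where "normalizes M (\<mu> 2) (\<mu> 1) (\<mu> 0)"
    using normalizes_exists assms(1) by metis
  from normalizes_combination[OF this, of u] have "u 1 = 0" "u 0 = 0"
    using assms(2,3) by (auto simp: vec_eq_iff forall_2)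
  moreover from this have "u 2 = 0"
    using assms(2) sum_3_eq[of "0::3" 1 2 u] by simp
  ultimately show ?thesis
    using exhaust_012[of l] by auto
qed

text \<open>
  The affine function \<open>x \<mapsto> v l \<bullet> x - d l\<close> vanishes on two vertices, so it is a positive multiple of the
  \<open>l\<close>-th barycentric coordinate.
\<close>

lemma interior_P_plus_iff:
  fixes \<mu> :: "3 \<Rightarrow> real^2"
  assumes el: "edge_lines \<mu> v d" and ijk: "i \<noteq> j" "k \<noteq> i" "k \<noteq> j"
    and s: "sum s UNIV = 1" "x = (\<Sum>l\<in>UNIV. s l *\<^sub>R \<mu> l)"
  shows "x \<in> interior (P_plus \<mu> v d i j) \<longleftrightarrow> s i < 0 \<and> 0 < s j \<and> s j < 1 \<and> 0 < s k"
proof -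
  have v: "v l \<noteq> 0" and off: "v l \<bullet> \<mu> l \<noteq> d l" and on: "m \<noteq> l \<Longrightarrow> v l \<bullet> \<mu> m = d l" for l m
    using el by (auto simp: edge_lines_def hyperplane_def)
  have "\<mu> l \<in> (\<Inter>i. halfspace_ge (v i) (d i))" for l
    using el hull_subset[of "range \<mu>" convex] by (auto simp: edge_lines_def)
  then have gt: "v l \<bullet> \<mu> l > d l" for l
    using off[of l] by (auto simp: halfspace_ge_def order.strict_iff_order)
  have height: "v l \<bullet> x - d l = s l * (v l \<bullet> \<mu> l - d l)" for l
  proof -
    have "v l \<bullet> x - d l = (\<Sum>m\<in>UNIV. s m * (v l \<bullet> \<mu> m)) - sum s UNIV * d l"
      using s by (simp add: inner_sum_right)
    also have "\<dots> = (\<Sum>m\<in>UNIV. s m * (v l \<bullet> \<mu> m - d l))"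
      by (simp add: sum_distrib_right sum_subtractf right_diff_distrib)
    also have "\<dots> = (\<Sum>m\<in>UNIV. if m = l then s l * (v l \<bullet> \<mu> l - d l) else 0)"
      using on by (intro sum.cong) auto
    finally show ?thesis
      by simp
  qed
  have "{l. l \<noteq> i} = {j, k}"
    using UNIV_3_eq[OF ijk] ijk by auto
  then have "P_plus \<mu> v d i j = {x. d j \<le> v j \<bullet> x} \<inter> {x. d k \<le> v k \<bullet> x} \<inter> {x. v i \<bullet> x \<le> d i}
      \<inter> {x. v j \<bullet> x \<le> v j \<bullet> \<mu> j}"
    by (auto simp: P_plus_def halfspace_ge_def halfspace_le_def)
  then have "x \<in> interior (P_plus \<mu> v d i j) \<longleftrightarrow>
      0 < v j \<bullet> x - d j \<and> 0 < v k \<bullet> x - d k \<and> v i \<bullet> x - d i < 0 \<and> v j \<bullet> x - d j < v j \<bullet> \<mu> j - d j"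
    using v by (auto simp: interior_halfspace_ge interior_halfspace_le)
  then show ?thesis
    unfolding height using gt by (auto simp: zero_less_mult_iff mult_less_0_iff not_less less_imp_le dest: less_asym)
qed

section \<open>Characterization of two critical points\<close>

text \<open>
  A kernel vector is determined by its entries at \<open>\<alpha>\<^sub>4\<close> and \<open>\<alpha>\<^sub>5\<close>, and the entry of \<open>B *v hat \<mu>\<close> at \<open>\<alpha>\<^sub>5\<close> is
  \<open>- 1\<close>. So minus the entry at \<open>\<alpha>\<^sub>4\<close>, which is a nonconstant affine function of \<open>\<mu>\<close>, can replace \<open>\<mu>\<close> as
  the parameter.
\<close>

lemma card_critical_points_eq:
  fixes \<mu> :: "3 \<Rightarrow> real^2" and \<alpha> :: "real^2^5"
  assumes gd: "gale_dual \<alpha> B" and B5: "B $ 5 = vector [0, -1]"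
    and eps: "\<epsilon> $ 1 = 1" "\<epsilon> $ 2 = 1" "\<epsilon> $ 3 = 1" "\<epsilon> $ 4 = -1" "\<epsilon> $ 5 = -1"
    and \<mu>: "\<mu> 0 = \<alpha> $ 1" "\<mu> 1 = \<alpha> $ 2" "\<mu> 2 = \<alpha> $ 3"
    and dim: "aff_dim (convex hull (range \<mu>)) = 2"
    and s: "sum s UNIV = 1" "\<alpha> $ 4 = (\<Sum>l\<in>UNIV. s l *\<^sub>R \<mu> l)"
    and t: "sum t UNIV = 1" "\<alpha> $ 5 = (\<Sum>l\<in>UNIV. t l *\<^sub>R \<mu> l)"
  shows "card (critical_points B \<epsilon>) = card (critical_parameters s t)"
proof -
  define \<iota> :: "3 \<Rightarrow> 5" where "\<iota> l = (if l = 0 then 1 else if l = 1 then 2 else 3)" for l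
  have \<iota>: "\<iota> 0 = 1" "\<iota> 1 = 2" "\<iota> 2 = 3"
    by (simp_all add: \<iota>_def)
  have all5: "(\<forall>i. P i) \<longleftrightarrow> (\<forall>l. P (\<iota> l)) \<and> P 4 \<and> P 5" for P
    using exhaust_5 exhaust_012 \<iota> by metis
  have sum5: "(\<Sum>i\<in>UNIV. f i) = (\<Sum>l\<in>UNIV. f (\<iota> l)) + f 4 + f 5" for f :: "5 \<Rightarrow> 'a::comm_monoid_add"
    using sum_3_eq[of "0::3" 1 2 "f \<circ> \<iota>"] by (simp add: sum_5 \<iota>)
  have \<mu>\<iota>: "\<alpha> $ \<iota> l = \<mu> l" for l
    using exhaust_012[of l] \<mu> \<iota> by auto
  have signs: "\<epsilon> $ i \<in> {1, -1}" for i
    using eps exhaust_5[of i] by auto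
  have kernel: "(B *v \<gamma>) $ \<iota> l = - (s l * (B *v \<gamma>) $ 4 + t l * (B *v \<gamma>) $ 5)" for \<gamma> l
  proof -
    define x where "x = B *v \<gamma>"
    have "hat_matrix \<alpha> *v x = 0"
      using gale_dual_kernel[OF gd] by (auto simp: x_def)
    then have x: "(\<Sum>l\<in>UNIV. x $ \<iota> l) + x $ 4 + x $ 5 = 0"
      "(\<Sum>l\<in>UNIV. x $ \<iota> l *\<^sub>R \<mu> l) + x $ 4 *\<^sub>R \<alpha> $ 4 + x $ 5 *\<^sub>R \<alpha> $ 5 = 0"
      by (simp_all add: hat_matrix_kernel sum5 \<mu>\<iota>)
    define u where "u l = x $ \<iota> l + s l * x $ 4 + t l * x $ 5" for l
    have "sum u UNIV = 0"
      using x(1) s(1) t(1) by (simp add: u_def sum.distrib flip: sum_distrib_right)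
    moreover have "(\<Sum>l\<in>UNIV. u l *\<^sub>R \<mu> l) = 0"
      using x(2) unfolding s(2) t(2)
      by (simp add: u_def sum.distrib scaleR_left_distrib scaleR_sum_right mult.commute)
    ultimately have "u l = 0"
      by (rule triangle_affinely_independent[OF dim])
    then show ?thesis
      by (simp add: u_def x_def)
  qed
  have p5: "B $ 5 $ 1 = 0" and z5: "(B *v hat m) $ 5 = -1" for m
    using B5 by (simp_all add: B_hat)
  define f where "f m = - (B *v hat m) $ 4" for m
  have p: "B $ \<iota> l $ 1 = - s l * B $ 4 $ 1" for l
    using kernel[of "axis 1 1" l] p5 by (simp add: matrix_vector_mult_basis column_def)
  have z: "(B *v hat m) $ \<iota> l = f m * s l + t l" for m l
    using kernel[of "hat m" l] by (simp add: f_def z5)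
  have p4: "B $ 4 $ 1 \<noteq> 0"
    using gale_dual_first_column_nonzero[OF gd] p p5 all5[of "\<lambda>i. B $ i $ 1 = 0"] by auto
  have "bij f"
  proof (rule bijI')
    show "f x = f y \<longleftrightarrow> x = y" for x y
      using p4 by (simp add: f_def B_hat)
    show "\<exists>x. y = f x" for y
      using p4 by (intro exI[of _ "- (y + B $ 4 $ 2) / B $ 4 $ 1"]) (simp add: f_def B_hat)
  qed
  have "m \<in> critical_points B \<epsilon> \<longleftrightarrow> f m \<in> critical_parameters s t" for m
  proof -
    have dom: "m \<in> xi_dom B \<epsilon> \<longleftrightarrow> 0 < f m \<and> (\<forall>l. 0 < f m * s l + t l)"
    proof -
      have "\<epsilon> $ \<iota> l = 1" for l
        using exhaust_012[of l] eps \<iota> by auto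
      moreover have "sgn ((B *v hat m) $ 4) = -1 \<longleftrightarrow> 0 < f m"
        by (simp add: f_def sgn_if)
      ultimately show ?thesis
        using z5[of m] by (auto simp: xi_dom_def vec_eq_iff all5 z eps sgn_1_pos)
    qed
    have "(\<Sum>i\<in>UNIV. (B $ i $ 1)\<^sup>2 / (B *v hat m) $ i) = 0 \<longleftrightarrow>
        (\<Sum>l\<in>UNIV. s l * t l / (f m * s l + t l)) = 0" if pos: "0 < f m" "\<And>l. 0 < f m * s l + t l"
    proof -
      have "(s l)\<^sup>2 / (f m * s l + t l) = (s l - s l * t l / (f m * s l + t l)) / f m" for l
      proof -
        have "s l - s l * t l / (f m * s l + t l) = f m * (s l)\<^sup>2 / (f m * s l + t l)"
          using pos(2)[of l] by (simp add: diff_divide_eq_iff power2_eq_square algebra_simps)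
        then show ?thesis
          using pos(1) by simp
      qed
      then have "(\<Sum>l\<in>UNIV. (s l)\<^sup>2 / (f m * s l + t l)) =
          (1 - (\<Sum>l\<in>UNIV. s l * t l / (f m * s l + t l))) / f m"
        using s(1) by (simp add: sum_subtractf flip: sum_divide_distrib)
      moreover have "(\<Sum>i\<in>UNIV. (B $ i $ 1)\<^sup>2 / (B *v hat m) $ i) =
          (B $ 4 $ 1)\<^sup>2 * ((\<Sum>l\<in>UNIV. (s l)\<^sup>2 / (f m * s l + t l)) - 1 / f m)"
      proof -
        have "(B *v hat m) $ 4 = - f m"
          by (simp add: f_def)
        then show ?thesis
          by (simp add: sum5 z p p5 sum_distrib_left power_mult_distrib right_diff_distrib mult.commute)
      qed
      ultimately show ?thesis
        using pos(1) p4 by (simp add: diff_divide_distrib)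
    qed
    then show ?thesis
      unfolding critical_points_eq[OF gd signs] by (auto simp: dom critical_parameters_def)
  qed
  then have "critical_parameters s t = f ` critical_points B \<epsilon>"
    using \<open>bij f\<close> by (auto simp: bij_iff image_iff) metis
  then show ?thesis
    using \<open>bij f\<close> by (metis bij_is_inj card_image inj_on_subset subset_UNIV)
qed

theorem theorem5p5:
  fixes \<alpha> :: "real^2^5" and \<epsilon> :: "real^5" and B :: "real^2^5"
  assumes "signed_support \<alpha> \<epsilon>"
    and "aff_dim (convex hull (range (\<lambda>i. \<alpha> $ i))) = 2"
    and "gale_dual \<alpha> B"
    and "B $ 5 = vector [0, -1]"
    and "\<epsilon> $ 5 = -1"
  shows
    "(card (critical_points B \<epsilon>) = 2 \<longrightarrow>
        card (pos_support \<alpha> \<epsilon>) = 3 \<and> card (neg_support \<alpha> \<epsilon>) = 2 \<and>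
          aff_dim (convex hull (pos_support \<alpha> \<epsilon>)) = 2
      \<or> card (pos_support \<alpha> \<epsilon>) = 2 \<and> card (neg_support \<alpha> \<epsilon>) = 3 \<and>
          aff_dim (convex hull (neg_support \<alpha> \<epsilon>)) = 2)
   \<and> (pos_support \<alpha> \<epsilon> = {\<alpha> $ 1, \<alpha> $ 2, \<alpha> $ 3} \<and> neg_support \<alpha> \<epsilon> = {\<alpha> $ 4, \<alpha> $ 5} \<and>
      aff_dim (convex hull (pos_support \<alpha> \<epsilon>)) = 2 \<longrightarrow>
      (\<forall>(\<mu> :: 3 \<Rightarrow> real^2) v d.
        \<mu> 0 = \<alpha> $ 1 \<and> \<mu> 1 = \<alpha> $ 2 \<and> \<mu> 2 = \<alpha> $ 3 \<and> edge_lines \<mu> v d \<longrightarrow>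
        (card (critical_points B \<epsilon>) = 2 \<longleftrightarrow>
          (\<exists>i j k. i \<noteq> j \<and> k \<noteq> i \<and> k \<noteq> j \<and>
             \<alpha> $ 4 \<in> interior (P_plus \<mu> v d j i) \<and>
             \<alpha> $ 5 \<in> interior (P_plus \<mu> v d i j) \<and>
             (\<exists>M. normalizes M (\<mu> k) (\<mu> j) (\<mu> i) \<and>
                (let w = - (M *v \<mu> k)
                 in coordinate_inequalities (M *v \<alpha> $ 4 + w) (M *v \<alpha> $ 5 + w)))))))"
proof (intro conjI impI allI)
  assume "card (critical_points B \<epsilon>) = 2"
  then obtain m where "m \<in> critical_points B \<epsilon>"
    by fastforce
  then show "card (pos_support \<alpha> \<epsilon>) = 3 \<and> card (neg_support \<alpha> \<epsilon>) = 2 \<and>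
          aff_dim (convex hull (pos_support \<alpha> \<epsilon>)) = 2
      \<or> card (pos_support \<alpha> \<epsilon>) = 2 \<and> card (neg_support \<alpha> \<epsilon>) = 3 \<and>
          aff_dim (convex hull (neg_support \<alpha> \<epsilon>)) = 2"
    by (rule critical_point_support[OF assms(3,4,1)])
next
  fix \<mu> :: "3 \<Rightarrow> real^2" and v d
  assume supp: "pos_support \<alpha> \<epsilon> = {\<alpha> $ 1, \<alpha> $ 2, \<alpha> $ 3} \<and> neg_support \<alpha> \<epsilon> = {\<alpha> $ 4, \<alpha> $ 5} \<and>
      aff_dim (convex hull (pos_support \<alpha> \<epsilon>)) = 2"
    and \<mu>: "\<mu> 0 = \<alpha> $ 1 \<and> \<mu> 1 = \<alpha> $ 2 \<and> \<mu> 2 = \<alpha> $ 3 \<and> edge_lines \<mu> v d"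
  have inj: "\<alpha> $ i = \<alpha> $ j \<longleftrightarrow> i = j" for i j
    using assms(1) by (auto simp: signed_support_def inj_eq)
  have pos: "\<epsilon> $ i = 1" if "\<alpha> $ i \<in> pos_support \<alpha> \<epsilon>" for i
    using that by (auto simp: pos_support_def inj)
  have neg: "\<epsilon> $ i = -1" if "\<alpha> $ i \<in> neg_support \<alpha> \<epsilon>" for i
    using that by (auto simp: neg_support_def inj)
  have eps: "\<epsilon> $ 1 = 1" "\<epsilon> $ 2 = 1" "\<epsilon> $ 3 = 1" "\<epsilon> $ 4 = -1"
    using pos neg supp by auto
  have range_\<mu>: "range \<mu> = pos_support \<alpha> \<epsilon>"
    using \<mu> supp range_3_eq[of "0::3" 1 2 \<mu>] by auto
  have dim: "aff_dim (convex hull (range \<mu>)) = 2"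
    unfolding range_\<mu> using supp by blast
  obtain s where s: "sum s UNIV = 1" "\<alpha> $ 4 = (\<Sum>l\<in>UNIV. s l *\<^sub>R \<mu> l)"
    by (rule barycentric_coordinates_exist[OF dim])
  obtain t where t: "sum t UNIV = 1" "\<alpha> $ 5 = (\<Sum>l\<in>UNIV. t l *\<^sub>R \<mu> l)"
    by (rule barycentric_coordinates_exist[OF dim])
  have card: "card (critical_points B \<epsilon>) = card (critical_parameters s t)"
    using \<mu> by (intro card_critical_points_eq[OF assms(3,4) eps assms(5) _ _ _ dim s t]) auto
  \<comment> \<open>In barycentric coordinates the conditions for a fixed labelling become sign conditions and the
    count; the count alone already provides a labelling with these signs.\<close>
  have "(\<exists>i j k. i \<noteq> j \<and> k \<noteq> i \<and> k \<noteq> j \<and>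
             \<alpha> $ 4 \<in> interior (P_plus \<mu> v d j i) \<and>
             \<alpha> $ 5 \<in> interior (P_plus \<mu> v d i j) \<and>
             (\<exists>M. normalizes M (\<mu> k) (\<mu> j) (\<mu> i) \<and>
                (let w = - (M *v \<mu> k)
                 in coordinate_inequalities (M *v \<alpha> $ 4 + w) (M *v \<alpha> $ 5 + w)))) \<longleftrightarrow>
    (\<exists>i j k. i \<noteq> j \<and> k \<noteq> i \<and> k \<noteq> j \<and> (s j < 0 \<and> 0 < s i \<and> s i < 1 \<and> 0 < s k) \<and>
      (t i < 0 \<and> 0 < t j \<and> t j < 1 \<and> 0 < t k) \<and> card (critical_parameters s t) = 2)"
  proof (intro arg_cong[where f = Ex] ext conj_cong refl)
    fix i j k :: 3
    assume ijk: "i \<noteq> j" "k \<noteq> i" "k \<noteq> j"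
    show "\<alpha> $ 4 \<in> interior (P_plus \<mu> v d j i) \<longleftrightarrow> s j < 0 \<and> 0 < s i \<and> s i < 1 \<and> 0 < s k"
      using \<mu> ijk s by (intro interior_P_plus_iff) auto
    show "\<alpha> $ 5 \<in> interior (P_plus \<mu> v d i j) \<longleftrightarrow> t i < 0 \<and> 0 < t j \<and> t j < 1 \<and> 0 < t k"
      using \<mu> ijk t by (intro interior_P_plus_iff) auto
    assume sg: "s j < 0 \<and> 0 < s i \<and> s i < 1 \<and> 0 < s k" "t i < 0 \<and> 0 < t j \<and> t j < 1 \<and> 0 < t k"
    have "range \<mu> = {\<mu> k, \<mu> j, \<mu> i}"
      using ijk by (intro range_3_eq) auto
    then obtain M where M: "normalizes M (\<mu> k) (\<mu> j) (\<mu> i)"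
      using normalizes_exists dim by metis
    have "coordinate_inequalities (M *v \<alpha> $ 4 + - (M *v \<mu> k)) (M *v \<alpha> $ 5 + - (M *v \<mu> k)) \<longleftrightarrow>
        card (critical_parameters s t) = 2" if "normalizes M (\<mu> k) (\<mu> j) (\<mu> i)" for M
      using normalizes_combination[OF that ijk, of s] normalizes_combination[OF that ijk, of t] s t sg
      by (intro two_critical_parameters_iff_inequalities[OF ijk, symmetric]) auto
    then show "(\<exists>M. normalizes M (\<mu> k) (\<mu> j) (\<mu> i) \<and>
                (let w = - (M *v \<mu> k)
                 in coordinate_inequalities (M *v \<alpha> $ 4 + w) (M *v \<alpha> $ 5 + w))) \<longleftrightarrow>
        card (critical_parameters s t) = 2"
      using M by (auto simp: Let_def)
  qed
  also have "\<dots> \<longleftrightarrow> card (critical_points B \<epsilon>) = 2"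
    unfolding card using two_critical_parameters_signs[OF s(1) t(1)] by metis
  finally show "card (critical_points B \<epsilon>) = 2 \<longleftrightarrow>
          (\<exists>i j k. i \<noteq> j \<and> k \<noteq> i \<and> k \<noteq> j \<and>
             \<alpha> $ 4 \<in> interior (P_plus \<mu> v d j i) \<and>
             \<alpha> $ 5 \<in> interior (P_plus \<mu> v d i j) \<and>
             (\<exists>M. normalizes M (\<mu> k) (\<mu> j) (\<mu> i) \<and>
                (let w = - (M *v \<mu> k)
                 in coordinate_inequalities (M *v \<alpha> $ 4 + w) (M *v \<alpha> $ 5 + w))))"
    by (rule sym)
qed

end
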